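(* There exists a fixed constant $\alpha_0>0$ such that for all $\alpha\ge\alpha_0$, $$\int_0^\infty\frac{t^{\alpha+1}}{\sinh(\alpha t)}\frac{1}{1+t^2}\,dt-\int_0^\infty\frac{t^{\alpha}}{\sinh(\alpha t)}\frac{1}{1+t^2}\,dt>0.$$ *)

theory Defs
  imports "HOL-Analysis.Analysis"
begin

end

theory Submission
  imports Defs "HOL-Probability.Sinc_Integral" "HOL-Real_Asymp.Real_Asymp"
begin

text \<open>
  With \<open>w t = t powr \<alpha> / sinh (\<alpha> t)\<close> the claim is \<open>\<integral> w (t - 1) / (1 + t\<^sup>2) > 0\<close>, and the first-order
  Laplace contribution at the peak \<open>t = 1\<close> cancels. Since \<open>w' = \<alpha> w ((1 - t) / t - \<delta>)\<close>, where
  \<open>\<delta> = coth (\<alpha> t) - 1\<close> is tiny, integrating by parts twice turns the integral into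
  \<open>\<alpha>\<^sup>-\<^sup>2 \<integral> - w h'\<close> with \<open>h = (t + t\<^sup>2) / (1 + t\<^sup>2)\<^sup>2\<close> and \<open>- h' 1 = 1 / 4 > 0\<close>. The integrand
  \<open>- w h'\<close> is negative for small \<open>t\<close>; adding the exact derivative \<open>(w k)'\<close> with \<open>k = (1 / t - 1) / 32\<close>
  contributes the term \<open>\<alpha> w (1 - t)\<^sup>2 / (32 t\<^sup>2)\<close>, which makes it pointwise positive for large \<open>\<alpha>\<close>.
  Hence the original integrand exceeds everywhere the derivative of a function \<open>w q\<close> that
  vanishes at \<open>0\<close> and at infinity.
\<close>

section \<open>Positivity of an integral from a pointwise derivative bound\<close>

text \<open>Integrability of \<open>g\<close> on the half-line is not assumed, so the comparison
  runs on compact intervals exhausting it. There the integral of \<open>g\<close> is a difference of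
  values of \<open>G\<close>, which tends to 0. Strictness survives the limit because every interval
  contains [1, 2], where \<open>f - g\<close> contributes the fixed amount
  \<open>m > 0\<close>.\<close>

lemma set_integral_pos_if_gt_derivative:
  fixes f g G :: "real \<Rightarrow> real"
  assumes f: "set_integrable lborel {0<..} f" "continuous_on {0<..} f"
    and G: "\<And>t. t > 0 \<Longrightarrow> (G has_real_derivative g t) (at t)"
    and g: "continuous_on {0<..} g"
    and less: "\<And>t. t > 0 \<Longrightarrow> g t < f t"
    and lim0: "(G \<longlongrightarrow> 0) (at_right 0)" and lim_top: "(G \<longlongrightarrow> 0) at_top"
  shows "(LBINT t:{0<..}. f t) > 0"
proof -
  \<comment> \<open>The extra + 1 at the upper end makes [1, 2] part of every \<open>A n\<close>,
    already for n = 0.\<close>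
  define A where "A = (\<lambda>n::nat. {1 / real (Suc n)..real (Suc n) + 1})"
  define m where "m = integral {1..2} (\<lambda>t. f t - g t)"
  have diff_cont: "continuous_on {0<..} (\<lambda>t. f t - g t)"
    by (intro continuous_intros f g)
  have "m > 0"
  proof -
    have "continuous_on {1..2} (\<lambda>t. f t - g t)"
      by (rule continuous_on_subset[OF diff_cont]) auto
    then obtain x where x: "x \<in> {1..2}" "\<And>y. y \<in> {1..2} \<Longrightarrow> f x - g x \<le> f y - g y"
      using continuous_attains_inf[of "{1..2::real}"] by force
    have "integral {1..2::real} (\<lambda>_. f x - g x) \<le> m"
      unfolding m_def
      by (intro integral_le integrable_continuous_real continuous_intros
          continuous_on_subset[OF diff_cont]) (auto intro: x)
    moreover have "f x - g x > 0" using less[of x] x(1) by auto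
    ultimately show ?thesis by simp
  qed
  have bound: "G (real (Suc n) + 1) - G (1 / real (Suc n)) + m \<le> (LBINT t:A n. f t)" for n
  proof -
    let ?a = "1 / real (Suc n)" and ?b = "real (Suc n) + 1"
    have ab: "0 < ?a" "?a \<le> 1" "2 \<le> ?b" by auto
    have sub: "A n \<subseteq> {0<..}"
    proof
      fix x assume "x \<in> A n"
      then have "?a \<le> x" by (simp add: A_def)
      then show "x \<in> {0<..}" using less_le_trans[OF ab(1)] by simp
    qed
    have fint: "set_integrable lborel (A n) f"
      by (rule set_integrable_subset[OF f(1) _ sub]) (simp add: A_def)
    have "(g has_integral G ?b - G ?a) {?a..?b}"
    proof (rule fundamental_theorem_of_calculus)
      show "?a \<le> ?b" using ab by linarith
      show "(G has_vector_derivative g x) (at x within {?a..?b})" if "x \<in> {?a..?b}" for x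
      proof -
        have "x > 0" using that ab by (meson atLeastAtMost_iff less_le_trans)
        then show ?thesis
          using G has_real_derivative_iff_has_vector_derivative
            has_vector_derivative_at_within by blast
      qed
    qed
    then have gint: "g integrable_on A n" "integral (A n) g = G ?b - G ?a"
      unfolding A_def by (auto simp: has_integral_integrable_integral)
    have fint': "f integrable_on A n" "(LBINT t:A n. f t) = integral (A n) f"
      using set_borel_integral_eq_integral[OF fint] by auto
    have "m \<le> integral (A n) (\<lambda>t. f t - g t)"
      unfolding m_def
    proof (rule integral_subset_le)
      show "{1..2} \<subseteq> A n" using ab unfolding A_def by auto
      show "(\<lambda>t. f t - g t) integrable_on {1..2}"
        by (intro integrable_continuous_real continuous_on_subset[OF diff_cont]) auto
      show "(\<lambda>t. f t - g t) integrable_on A n"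
        using fint' gint by (intro integrable_diff)
      show "\<forall>x\<in>A n. 0 \<le> f x - g x"
        using less sub by (auto intro: less_imp_le)
    qed
    also have "\<dots> = integral (A n) f - integral (A n) g"
      using fint' gint by (intro Henstock_Kurzweil_Integration.integral_diff)
    finally show ?thesis using fint' gint by simp
  qed
  have "incseq A"
    unfolding A_def by (rule incseq_SucI) (auto simp: field_simps)
  moreover have Un: "(\<Union>n. A n) = {0<..}"
  proof (intro equalityI subsetI)
    fix x assume "x \<in> (\<Union>n. A n)"
    then show "x \<in> {0<..}"
      unfolding A_def by (auto intro: less_le_trans[rotated])
  next
    fix x :: real assume "x \<in> {0<..}"
    then have x: "x > 0" by simp
    obtain n :: nat where n: "max x (1/x) < real n" using reals_Archimedean2 by blast
    then have "1 / real (Suc n) \<le> x" using x by (simp add: field_simps)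
    then have "x \<in> A n" using n unfolding A_def by auto
    then show "x \<in> (\<Union>n. A n)" by blast
  qed
  ultimately have lim: "(\<lambda>n. LBINT t:A n. f t) \<longlonglongrightarrow> (LBINT t:{0<..}. f t)"
    using set_integral_cont_up[of A lborel f] f(1) by (simp add: A_def)
  have "(\<lambda>n. G (real (Suc n) + 1)) \<longlonglongrightarrow> 0"
    by (rule filterlim_compose[OF lim_top]) real_asymp
  moreover have "(\<lambda>n. G (1 / real (Suc n))) \<longlonglongrightarrow> 0"
    by (rule filterlim_compose[OF lim0]) real_asymp
  ultimately have "(\<lambda>n. G (real (Suc n) + 1) - G (1 / real (Suc n)) + m) \<longlonglongrightarrow> 0 - 0 + m"
    by (intro tendsto_intros)
  then have "m \<le> (LBINT t:{0<..}. f t)"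
    using LIMSEQ_le[OF _ lim] bound by force
  then show ?thesis using \<open>m > 0\<close> by simp
qed

section \<open>Elementary bounds for sinh and coth\<close>

lemma sinh_mult_exp: "sinh x * exp x = (exp (2 * x) - 1) / 2" for x :: real
proof -
  have "exp (2 * x) = exp x * exp x" by (simp flip: exp_add)
  then show ?thesis by (simp add: sinh_field_def field_simps exp_minus)
qed

text \<open>Write 2 sinh x = exp x (1 - exp (- 2 x)) and use exp (2 x) \<ge> 1 + 2 x. The bound is
  linear near 0 and keeps the full exponential rate at infinity, so it serves both estimates of the
  weight.\<close>

lemma sinh_lower_bound:
  fixes x :: real assumes "x > 0"
  shows "x * exp x / (1 + 2 * x) \<le> sinh x"
proof -
  have e: "1 + 2 * x \<le> exp (2 * x)" by (rule exp_ge_add_one_self)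
  have "1 / exp (2 * x) \<le> 1 / (1 + 2 * x)"
    using e assms by (intro divide_left_mono) auto
  then have "2 * x / (1 + 2 * x) \<le> 1 - 1 / exp (2 * x)"
    using assms by (simp add: field_simps)
  then have "exp x * (2 * x / (1 + 2 * x)) \<le> exp x * (1 - 1 / exp (2 * x))"
    by (intro mult_left_mono) auto
  moreover have "exp x * (1 - 1 / exp (2 * x)) = 2 * sinh x"
  proof -
    have "exp (2 * x) = exp x * exp x" by (simp flip: exp_add)
    then show ?thesis by (simp add: sinh_field_def field_simps exp_minus)
  qed
  moreover have "exp x * (2 * x / (1 + 2 * x)) = 2 * (x * exp x / (1 + 2 * x))"
    by simp
  ultimately show ?thesis by linarith
qed

text \<open>Squaring the quadratic Taylor bound for exp x yields a quartic below exp (2 x); keeping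
  only its linear or only its cubic term beside the 1 gives the two claims. Their reciprocals bound
  coth x - 1, with first and third order decay.\<close>

lemma sinh_mult_exp_ge:
  fixes x :: real assumes "x > 0"
  shows "x \<le> sinh x * exp x" and "x ^ 3 / 2 \<le> sinh x * exp x"
proof -
  have q: "1 + x + x\<^sup>2 / 2 \<le> exp x"
    using exp_lower_Taylor_quadratic[of x] assms by simp
  have "(1 + x + x\<^sup>2 / 2)\<^sup>2 \<le> (exp x)\<^sup>2"
    using q assms by (intro power_mono) auto
  also have "(exp x)\<^sup>2 = exp (2 * x)" by (simp add: power2_eq_square flip: exp_add)
  finally have "1 + 2 * x + 2 * x\<^sup>2 + x ^ 3 + x ^ 4 / 4 \<le> exp (2 * x)"
    by (simp add: power2_eq_square power3_eq_cube power4_eq_xxxx field_simps)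
  moreover have "0 < x\<^sup>2" "0 < x ^ 3" "0 \<le> x ^ 4 / 4" using assms by auto
  ultimately have "1 + 2 * x \<le> exp (2 * x)" "1 + x ^ 3 \<le> exp (2 * x)"
    using assms by argo+
  then show "x \<le> sinh x * exp x" "x ^ 3 / 2 \<le> sinh x * exp x"
    unfolding sinh_mult_exp by argo+
qed

text \<open>This is cosh x - sinh x = exp (- x) divided by sinh x; it isolates the exponentially
  small excess of coth over 1.\<close>

lemma cosh_div_sinh: "x \<noteq> 0 \<Longrightarrow> cosh x / sinh x = 1 + 1 / (sinh x * exp x)" for x :: real
proof -
  assume "x \<noteq> 0"
  then have "sinh x \<noteq> 0" by simp
  moreover have "cosh x = sinh x + 1 / exp x"
    by (simp add: sinh_field_def cosh_field_def field_simps exp_minus)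
  ultimately show ?thesis by (simp add: field_simps)
qed

section \<open>The weight: derivative and decay\<close>

definition sinh_weight :: "real \<Rightarrow> real \<Rightarrow> real" where
  "sinh_weight \<alpha> t = t powr \<alpha> / sinh (\<alpha> * t)"

lemma sinh_weight_pos: "\<alpha> > 0 \<Longrightarrow> t > 0 \<Longrightarrow> sinh_weight \<alpha> t > 0"
  by (simp add: sinh_weight_def)

text \<open>The logarithmic derivative is \<alpha> / t - \<alpha> coth (\<alpha> t). Splitting coth
  into 1 plus its excess exhibits the factor 1 / t - 1, which vanishes at the peak t = 1.\<close>

lemma sinh_weight_deriv:
  assumes "\<alpha> > 0" "t > 0"
  shows "(sinh_weight \<alpha> has_real_derivative
    sinh_weight \<alpha> t * (\<alpha> * (1 / t - 1 - 1 / (sinh (\<alpha> * t) * exp (\<alpha> * t))))) (at t)"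
proof -
  have s: "sinh (\<alpha> * t) > 0" using assms by simp
  have p: "t powr (\<alpha> - 1) = t powr \<alpha> / t" using assms by (simp add: powr_diff)
  have c: "cosh (\<alpha> * t) = sinh (\<alpha> * t) * (1 + 1 / (sinh (\<alpha> * t) * exp (\<alpha> * t)))"
    using cosh_div_sinh[of "\<alpha> * t"] assms s
    by (metis less_irrefl mult_pos_pos nonzero_mult_div_cancel_left times_divide_eq_right)
  have "((\<lambda>t. t powr \<alpha> / sinh (\<alpha> * t)) has_real_derivative
    (\<alpha> * t powr (\<alpha> - 1) * sinh (\<alpha> * t) - t powr \<alpha> * (cosh (\<alpha> * t) * \<alpha>)) /
      (sinh (\<alpha> * t) * sinh (\<alpha> * t))) (at t)"
    using assms s by (auto intro!: derivative_eq_intros)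
  moreover have "(\<alpha> * t powr (\<alpha> - 1) * sinh (\<alpha> * t) - t powr \<alpha> * (cosh (\<alpha> * t) * \<alpha>)) /
      (sinh (\<alpha> * t) * sinh (\<alpha> * t)) =
    sinh_weight \<alpha> t * (\<alpha> * (1 / t - 1 - 1 / (sinh (\<alpha> * t) * exp (\<alpha> * t))))"
    unfolding sinh_weight_def p c using s assms by (simp add: field_simps)
  ultimately show ?thesis
    unfolding sinh_weight_def[abs_def] by metis
qed

text \<open>Controls the weight near 0: sinh (\<alpha> t) \<ge> \<alpha> t / 2 \<ge> t costs only
  one power of t.\<close>

lemma sinh_weight_le_powr:
  assumes "\<alpha> \<ge> 2" "t > 0"
  shows "sinh_weight \<alpha> t \<le> t powr (\<alpha> - 1)"
proof -
  define x where "x = \<alpha> * t"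
  have x: "x > 0" "2 * t \<le> x" using assms by (auto simp: x_def)
  have "x / 2 \<le> x * (1 + x) / (1 + 2 * x)" using x by (simp add: field_simps)
  also have "\<dots> \<le> x * exp x / (1 + 2 * x)"
    using x exp_ge_add_one_self[of x] by (intro divide_right_mono mult_left_mono) auto
  also have "\<dots> \<le> sinh x" by (rule sinh_lower_bound) (use x in auto)
  finally have "t \<le> sinh (\<alpha> * t)" using x by (simp add: x_def)
  then have "t powr \<alpha> / sinh (\<alpha> * t) \<le> t powr \<alpha> / t"
    using assms by (intro divide_left_mono) auto
  then show ?thesis using assms by (simp add: sinh_weight_def powr_diff)
qed

text \<open>Since ln t \<le> t / 2, the power of t grows at no more than half the rate of the sinh.
  What remains is exp (- (\<alpha> + 1) t / 2) times a factor below exp (2 t), which is enough once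
  \<alpha> \<ge> 10.\<close>

lemma sinh_weight_le_exp:
  assumes "\<alpha> \<ge> 10" "t > 0"
  shows "sinh_weight \<alpha> t \<le> exp (- 3 * t)"
proof -
  \<comment> \<open>Tangent line of ln at 2; the constant left over is ln 2 - 1 \<le> 0.\<close>
  have "ln (t / 2) \<le> t / 2 - 1" using assms by (intro ln_le_minus_one) auto
  moreover have "ln (t / 2) = ln t - ln 2" using assms by (simp add: ln_div)
  moreover have "ln (2::real) \<le> 1" using ln_le_minus_one[of "2::real"] by simp
  ultimately have l: "ln t \<le> t / 2" by linarith
  have "(\<alpha> - 1) * ln t \<le> (\<alpha> - 1) * (t / 2)"
    using l assms by (intro mult_left_mono) auto
  then have p: "t powr (\<alpha> - 1) \<le> exp ((\<alpha> - 1) * (t / 2))"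
    using assms by (simp add: powr_def)
  have s: "sinh (\<alpha> * t) > 0" using assms by simp
  have "sinh_weight \<alpha> t \<le> t powr \<alpha> / (\<alpha> * t * exp (\<alpha> * t) / (1 + 2 * (\<alpha> * t)))"
    unfolding sinh_weight_def using assms s sinh_lower_bound[of "\<alpha> * t"]
    by (intro divide_left_mono) (auto intro!: mult_pos_pos divide_pos_pos add_pos_pos)
  also have "\<dots> = t powr (\<alpha> - 1) * exp (- (\<alpha> * t)) * (1 / \<alpha> + 2 * t)"
    using assms by (simp add: powr_diff exp_minus field_simps)
  also have "\<dots> \<le> exp ((\<alpha> - 1) * (t / 2)) * exp (- (\<alpha> * t)) * (1 + 2 * t)"
    using assms p by (intro mult_mono) auto
  also have "\<dots> \<le> exp ((\<alpha> - 1) * (t / 2)) * exp (- (\<alpha> * t)) * exp (2 * t)"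
    by (intro mult_left_mono exp_ge_add_one_self) auto
  also have "\<dots> = exp ((\<alpha> - 1) * (t / 2) - \<alpha> * t + 2 * t)"
    by (simp flip: exp_add)
  also have "\<dots> \<le> exp (- 3 * t)"
  proof -
    have "(\<alpha> - 1) * (t / 2) - \<alpha> * t + 2 * t = - (\<alpha> + 1) / 2 * t + 2 * t"
      by (simp add: field_simps)
    moreover have "10 * t \<le> \<alpha> * t" using assms by simp
    ultimately have "(\<alpha> - 1) * (t / 2) - \<alpha> * t + 2 * t \<le> - 3 * t"
      using assms(2) by (simp add: field_simps)
    then show ?thesis by simp
  qed
  finally show ?thesis .
qed

section \<open>The pointwise inequality\<close>

text \<open>The expression is the gap between integrand and derivative, after estimating the
  \<delta> terms, divided by the weight and scaled by \<open>\<alpha>\<^sup>2 * t\<^sup>2\<close>.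
  At t = 1 the rational term equals 1/4 and beats the cost 1/32 of the correction \<open>k\<close>.
  Away from 1 that term may be negative but stays above -3, and the square times \<alpha> dominates.
  The threshold for \<alpha> leaves ample room in both cases.\<close>

lemma remainder_pos:
  fixes t \<alpha> :: real
  assumes t: "t > 0" and \<alpha>: "\<alpha> \<ge> 100000"
  shows "t\<^sup>2 * ((2 * t ^ 3 + 3 * t\<^sup>2 - 2 * t - 1) / (1 + t\<^sup>2) ^ 3)
    + (\<alpha> * (1 - t)\<^sup>2 - 1 - \<bar>1 - t\<bar>) / 32 - 2 / \<alpha> > 0"
proof -
  define Q where "Q = t\<^sup>2 * ((2 * t ^ 3 + 3 * t\<^sup>2 - 2 * t - 1) / (1 + t\<^sup>2) ^ 3)"
  define s where "s = \<bar>1 - t\<bar>"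
  have s2: "(1 - t)\<^sup>2 = s\<^sup>2" "s \<ge> 0" by (auto simp: s_def)
  have a: "2 / \<alpha> \<le> 1 / 1000" using \<alpha> by (simp add: field_simps)
  have d: "(1 + t\<^sup>2) ^ 3 > 0" by (intro zero_less_power add_pos_nonneg) auto
  have "Q + (\<alpha> * s\<^sup>2 - 1 - s) / 32 - 2 / \<alpha> > 0"
  proof (cases "s \<le> 1 / 10")
    case True
    then have t2: "9 / 10 \<le> t" "t \<le> 11 / 10" unfolding s_def by linarith+
    have p2: "(9 / 10)\<^sup>2 \<le> t\<^sup>2" "t\<^sup>2 \<le> (11 / 10)\<^sup>2"
      using t2 by (auto intro!: power_mono)
    have "(81 / 100) * 1 \<le> t\<^sup>2 * (2 * t ^ 3 + 3 * t\<^sup>2 - 2 * t - 1)"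
    proof (rule mult_mono)
      \<comment> \<open>136/125 is the value of the cubic at 9/10, so t - 9/10 divides the
        difference; the quotient has positive coefficients.\<close>
      have "(2 * t ^ 3 + 3 * t\<^sup>2 - 2 * t - 1) - 136/125 =
          (t - 9/10) * (2 * t\<^sup>2 + 24/5 * t + 58/25)"
        by (simp add: power2_eq_square power3_eq_cube field_simps)
      moreover have "(t - 9/10) * (2 * t\<^sup>2 + 24/5 * t + 58/25) \<ge> 0"
        using t2 by (intro mult_nonneg_nonneg) auto
      ultimately show "1 \<le> 2 * t ^ 3 + 3 * t\<^sup>2 - 2 * t - 1" by linarith
    qed (use p2 in \<open>auto simp: power2_eq_square\<close>)
    moreover have "(1 + t\<^sup>2) ^ 3 \<le> (1 + (11/10)\<^sup>2) ^ 3"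
      using p2 by (intro power_mono) auto
    then have "(1 + t\<^sup>2) ^ 3 \<le> 11" by (simp add: power2_eq_square power3_eq_cube)
    \<comment> \<open>The numerator is at least 0.81 and 0.07 * 11 = 0.77. The bound 0.07 exceeds
      the possible loss 1.1/32 + 1/1000.\<close>
    ultimately have "7 / 100 * (1 + t\<^sup>2) ^ 3 \<le> t\<^sup>2 * (2 * t ^ 3 + 3 * t\<^sup>2 - 2 * t - 1)"
      by linarith
    then have "7 / 100 \<le> Q" unfolding Q_def using d by (simp add: pos_le_divide_eq)
    moreover have "\<alpha> * s\<^sup>2 \<ge> 0" using \<alpha> by simp
    ultimately show ?thesis using a True by (simp add: field_simps)
  next
    case False
    \<comment> \<open>Only - 2 t ^ 3 - t ^ 2 is negative. The inequality 2 t \<le> 1 + t ^ 2 turns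
      it into even powers, which the expanded cube dominates coefficientwise.\<close>
    have "- 3 * (1 + t\<^sup>2) ^ 3 \<le> t\<^sup>2 * (2 * t ^ 3 + 3 * t\<^sup>2 - 2 * t - 1)"
    proof -
      have "2 * t \<le> 1 + t\<^sup>2" using sum_squares_bound[of 1 t] by simp
      then have "t\<^sup>2 * (2 * t) \<le> t\<^sup>2 * (1 + t\<^sup>2)" by (intro mult_left_mono) auto
      moreover have "t\<^sup>2 * (2 * t ^ 3 + 3 * t\<^sup>2 - 2 * t - 1) =
          2 * t ^ 5 + 3 * t ^ 4 - t\<^sup>2 * (2 * t) - t\<^sup>2"
        by (simp add: eval_nat_numeral algebra_simps)
      moreover have "(1 + t\<^sup>2) ^ 3 = 1 + 3 * t\<^sup>2 + 3 * t ^ 4 + t ^ 6"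
        "t\<^sup>2 * (1 + t\<^sup>2) = t\<^sup>2 + t ^ 4"
        by (simp_all add: eval_nat_numeral algebra_simps)
      moreover have "t\<^sup>2 > 0" "t ^ 4 > 0" "t ^ 5 > 0" "t ^ 6 > 0" using t by auto
      ultimately show ?thesis by linarith
    qed
    then have "- 3 \<le> Q" unfolding Q_def using d by (simp add: pos_le_divide_eq)
    \<comment> \<open>Trading one factor s for its lower bound 1/10 leaves a bound linear in s,
      which absorbs the linear loss s / 32 for all s and the constant -3.\<close>
    moreover have "100000 * ((1 / 10) * s) \<le> \<alpha> * s\<^sup>2"
      unfolding power2_eq_square using \<alpha> False s2 by (intro mult_mono) auto
    ultimately show ?thesis using a False by argo
  qed
  then show ?thesis unfolding Q_def s2 s_def[symmetric] .
qed

text \<open>Here \<open>\<delta>\<close> stands for \<open>coth (\<alpha> t) - 1\<close>, and \<open>dh\<close>, \<open>dq\<close> are the derivatives of \<open>h\<close>, \<open>q\<close>; after division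
  by the weight, the left-hand side is the derivative of weight times \<open>q\<close>.\<close>

lemma derivative_lt_integrand:
  fixes t \<alpha> \<delta> h k dh :: real
  assumes t: "t > 0" and \<alpha>: "\<alpha> \<ge> 100000"
    and \<delta>: "0 \<le> \<delta>" "\<delta> \<le> 1 / (\<alpha> * t)" "\<delta> \<le> 2 / (\<alpha> * t) ^ 3"
    and h: "h = (t + t\<^sup>2) / (1 + t\<^sup>2)\<^sup>2" and k: "k = (1 / t - 1) / 32"
    and dh: "dh = - (2 * t ^ 3 + 3 * t\<^sup>2 - 2 * t - 1) / (1 + t\<^sup>2) ^ 3"
  defines "q \<equiv> - t / (\<alpha> * (1 + t\<^sup>2)) + (h - k) / \<alpha>\<^sup>2"
    and "dq \<equiv> - (1 - t\<^sup>2) / (\<alpha> * (1 + t\<^sup>2)\<^sup>2) + (dh + 1 / (32 * t\<^sup>2)) / \<alpha>\<^sup>2"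
  shows "\<alpha> * (1 / t - 1 - \<delta>) * q + dq < (t - 1) / (1 + t\<^sup>2)"
proof -
  have nz: "1 + t\<^sup>2 > 0" by (intro add_pos_nonneg) auto
  \<comment> \<open>The leading term of \<open>q\<close> reproduces the integrand exactly
    (\<open>e2\<close>), but its own derivative is left over at order 1 / \<alpha>. The function
    \<open>h\<close> is chosen so that this leftover is cancelled (\<open>e1\<close>).\<close>
  have e1: "(1 / t - 1) * h = (1 - t\<^sup>2) / (1 + t\<^sup>2)\<^sup>2"
  proof -
    have "(1 / t - 1) * (t + t\<^sup>2) = 1 - t\<^sup>2" using t by (simp add: power2_eq_square field_simps)
    then show ?thesis unfolding h by (metis times_divide_eq_right)
  qed
  have e2: "(1 / t - 1) * (t / (1 + t\<^sup>2)) = (1 - t) / (1 + t\<^sup>2)"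
  proof -
    have "(1 / t - 1) * t = 1 - t" using t by (simp add: field_simps)
    then show ?thesis by (metis times_divide_eq_right)
  qed
  \<comment> \<open>Because \<open>k\<close> has the same zero at t = 1 as the factor 1 / t - 1, the
    product is a square, hence a gain of definite sign.\<close>
  have e3: "(1 / t - 1) * k = (1 - t)\<^sup>2 / t\<^sup>2 / 32"
    unfolding k using t by (simp add: field_simps power2_eq_square)
  have q': "q = - (t / (1 + t\<^sup>2)) / \<alpha> + h / \<alpha>\<^sup>2 - k / \<alpha>\<^sup>2"
    unfolding q_def using \<alpha> nz by (simp add: field_simps)
  have "\<alpha> * (1 / t - 1) * q = - ((1 / t - 1) * (t / (1 + t\<^sup>2))) + (1 / t - 1) * h / \<alpha>
      - (1 / t - 1) * k / \<alpha>"
  proof -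
    have "\<alpha> * r * (- u / \<alpha> + h / \<alpha>\<^sup>2 - k / \<alpha>\<^sup>2) = - (r * u) + r * h / \<alpha> - r * k / \<alpha>"
      for r u :: real
      using \<alpha> by (simp add: field_simps power2_eq_square)
    then show ?thesis unfolding q' .
  qed
  also have "\<dots> = (t - 1) / (1 + t\<^sup>2) + (1 - t\<^sup>2) / (\<alpha> * (1 + t\<^sup>2)\<^sup>2)
      - (1 - t)\<^sup>2 / t\<^sup>2 / 32 / \<alpha>"
    unfolding e1 e2 e3 by (simp add: minus_divide_left mult.commute)
  \<comment> \<open>The exact gap when \<delta> is set to 0; the terms containing \<delta> are
    estimated next.\<close>
  finally have main: "(t - 1) / (1 + t\<^sup>2) - (\<alpha> * (1 / t - 1) * q + dq) =
      (1 - t)\<^sup>2 / t\<^sup>2 / 32 / \<alpha> - (dh + 1 / (32 * t\<^sup>2)) / \<alpha>\<^sup>2"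
    unfolding dq_def minus_divide_left[symmetric] by simp
  have "- (\<alpha> * \<delta> * q) \<le> \<delta> * t + \<delta> * (\<bar>1 - t\<bar> / t / 32) / \<alpha>"
  proof -
    have h0: "h \<ge> 0" unfolding h using t by auto
    have k0: "k \<le> \<bar>1 - t\<bar> / t / 32"
    proof -
      have "k = (1 - t) / t / 32" unfolding k using t by (simp add: field_simps)
      also have "\<dots> \<le> \<bar>1 - t\<bar> / t / 32" using t by (intro divide_right_mono) auto
      finally show ?thesis .
    qed
    have "t / (1 + t\<^sup>2) \<le> t / 1" using t nz by (intro divide_left_mono) auto
    then have "\<delta> * (t / (1 + t\<^sup>2)) \<le> \<delta> * t" using \<delta> by (intro mult_left_mono) auto
    moreover have "\<delta> * (k - h) / \<alpha> \<le> \<delta> * (\<bar>1 - t\<bar> / t / 32) / \<alpha>"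
      using \<delta> h0 k0 \<alpha> by (intro divide_right_mono mult_left_mono) auto
    moreover have "- (\<alpha> * \<delta> * q) = \<delta> * (t / (1 + t\<^sup>2)) + \<delta> * (k - h) / \<alpha>"
    proof -
      have "- (\<alpha> * \<delta> * (- u / \<alpha> + h / \<alpha>\<^sup>2 - k / \<alpha>\<^sup>2)) = \<delta> * u + \<delta> * (k - h) / \<alpha>" for u
        using \<alpha> by (simp add: field_simps power2_eq_square)
      then show ?thesis unfolding q' .
    qed
    ultimately show ?thesis by linarith
  qed
  \<comment> \<open>The two bounds on \<delta> are used where each fits: the cubic one here, the
    linear one for the part with \<open>k\<close>, which already carries 1 / \<alpha>. Both errors
    then contain the factor \<open>1 / (t\<^sup>2 * \<alpha>\<^sup>2)\<close> and match the scaling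
    of \<open>?R\<close>. The part with \<open>h\<close> has a favourable sign and was
    dropped.\<close>
  also have "\<delta> * t \<le> 2 / (\<alpha> * t) ^ 3 * t" using \<delta> t by (intro mult_right_mono) auto
  also have "2 / (\<alpha> * t) ^ 3 * t = 2 / \<alpha> / t\<^sup>2 / \<alpha>\<^sup>2"
    using t \<alpha> by (simp add: field_simps power2_eq_square power3_eq_cube)
  also have "\<delta> * (\<bar>1 - t\<bar> / t / 32) / \<alpha> \<le> 1 / (\<alpha> * t) * (\<bar>1 - t\<bar> / t / 32) / \<alpha>"
    using \<delta> t \<alpha> by (intro divide_right_mono mult_right_mono) auto
  also have "1 / (\<alpha> * t) * (\<bar>1 - t\<bar> / t / 32) / \<alpha> = \<bar>1 - t\<bar> / 32 / t\<^sup>2 / \<alpha>\<^sup>2"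
    by (simp add: power2_eq_square)
  finally have err: "- (\<alpha> * \<delta> * q) \<le> 2 / \<alpha> / t\<^sup>2 / \<alpha>\<^sup>2 + \<bar>1 - t\<bar> / 32 / t\<^sup>2 / \<alpha>\<^sup>2"
    by simp
  let ?R = "t\<^sup>2 * ((2 * t ^ 3 + 3 * t\<^sup>2 - 2 * t - 1) / (1 + t\<^sup>2) ^ 3)
    + (\<alpha> * (1 - t)\<^sup>2 - 1 - \<bar>1 - t\<bar>) / 32 - 2 / \<alpha>"
  have Q: "t\<^sup>2 * ((2 * t ^ 3 + 3 * t\<^sup>2 - 2 * t - 1) / (1 + t\<^sup>2) ^ 3) = - (t\<^sup>2 * dh)"
    unfolding dh minus_divide_left[symmetric] by simp
  have "0 < ?R / t\<^sup>2 / \<alpha>\<^sup>2"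
    using remainder_pos[OF t \<alpha>] t \<alpha> by (intro divide_pos_pos) auto
  also have "?R / t\<^sup>2 / \<alpha>\<^sup>2 = (1 - t)\<^sup>2 / t\<^sup>2 / 32 / \<alpha> - (dh + 1 / (32 * t\<^sup>2)) / \<alpha>\<^sup>2
      - (2 / \<alpha> / t\<^sup>2 / \<alpha>\<^sup>2 + \<bar>1 - t\<bar> / 32 / t\<^sup>2 / \<alpha>\<^sup>2)"
    unfolding Q using t \<alpha> by (simp add: divide_simps) (simp add: algebra_simps power2_eq_square)
  also have "\<dots> \<le> (t - 1) / (1 + t\<^sup>2) - (\<alpha> * (1 / t - 1) * q + dq) + \<alpha> * \<delta> * q"
    unfolding main using err by linarith
  also have "\<dots> = (t - 1) / (1 + t\<^sup>2) - (\<alpha> * (1 / t - 1 - \<delta>) * q + dq)"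
    by (simp add: algebra_simps)
  finally show ?thesis by simp
qed

section \<open>Assembly: integrability, derivatives and boundary values\<close>

theorem theorem5p1:
  "\<exists>\<alpha>\<^sub>0::real. \<alpha>\<^sub>0 > 0 \<and> (\<forall>\<alpha>\<ge>\<alpha>\<^sub>0.
     (LBINT t:{0<..}. t powr (\<alpha> + 1) / sinh (\<alpha> * t) * (1 / (1 + t\<^sup>2)))
   - (LBINT t:{0<..}. t powr \<alpha> / sinh (\<alpha> * t) * (1 / (1 + t\<^sup>2))) > 0)"
proof (intro exI[of _ 100000] conjI allI impI)
  fix \<alpha> :: real assume \<alpha>: "\<alpha> \<ge> 100000"
  define w where "w = sinh_weight \<alpha>"
  define f1 where "f1 = (\<lambda>t. t powr (\<alpha> + 1) / sinh (\<alpha> * t) * (1 / (1 + t\<^sup>2)))"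
  define f0 where "f0 = (\<lambda>t. t powr \<alpha> / sinh (\<alpha> * t) * (1 / (1 + t\<^sup>2)))"
  define h where "h = (\<lambda>t::real. (t + t\<^sup>2) / (1 + t\<^sup>2)\<^sup>2)"
  define k where "k = (\<lambda>t::real. (1 / t - 1) / 32)"
  define dh where "dh = (\<lambda>t::real. - (2 * t ^ 3 + 3 * t\<^sup>2 - 2 * t - 1) / (1 + t\<^sup>2) ^ 3)"
  define q where "q = (\<lambda>t. - t / (\<alpha> * (1 + t\<^sup>2)) + (h t - k t) / \<alpha>\<^sup>2)"
  define dq where "dq = (\<lambda>t. - (1 - t\<^sup>2) / (\<alpha> * (1 + t\<^sup>2)\<^sup>2) + (dh t + 1 / (32 * t\<^sup>2)) / \<alpha>\<^sup>2)"
  define \<delta> where "\<delta> = (\<lambda>t. 1 / (sinh (\<alpha> * t) * exp (\<alpha> * t)))"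
  define g where "g = (\<lambda>t. w t * (\<alpha> * (1 / t - 1 - \<delta> t)) * q t + w t * dq t)"
  have nz: "1 + t\<^sup>2 > 0" for t :: real by (intro add_pos_nonneg) auto
  then have nz': "1 + t\<^sup>2 \<noteq> 0" for t :: real by (metis less_irrefl)
  have f0: "f0 t = w t / (1 + t\<^sup>2)" for t
    by (simp add: f0_def w_def sinh_weight_def)
  have f1: "f1 t = t * w t / (1 + t\<^sup>2)" if "t > 0" for t
    using that by (simp add: f1_def w_def sinh_weight_def powr_add)
  have wpos: "w t > 0" if "t > 0" for t
    using sinh_weight_pos that \<alpha> by (simp add: w_def)
  have wexp: "w t \<le> exp (- 3 * t)" if "t > 0" for t
    using sinh_weight_le_exp that \<alpha> by (simp add: w_def)
  have cont: "continuous_on {0<..} f0" "continuous_on {0<..} f1"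
    unfolding f0_def f1_def using \<alpha> nz' by (auto intro!: continuous_intros)
  have meas: "set_borel_measurable lborel {0<..} f0" "set_borel_measurable lborel {0<..} f1"
    using borel_measurable_continuous_on_indicator[OF _ cont(1)]
      borel_measurable_continuous_on_indicator[OF _ cont(2)]
    by (auto simp: set_borel_measurable_def)
  \<comment> \<open>exp (- t) dominates both integrands: the rate 3 in \<open>wexp\<close> leaves
    room to absorb the additional factor t \<le> exp t of \<open>f1\<close>.\<close>
  have E: "set_integrable lborel {0<..} (\<lambda>t::real. exp (- t))"
    using integrable_I0i_exp_mscale[of 1] by simp
  have b0: "norm (f0 t) \<le> norm (exp (- t))" if "t > 0" for t
  proof -
    have "w t / (1 + t\<^sup>2) \<le> w t / 1" using wpos[OF that] nz[of t] by (intro divide_left_mono) auto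
    also have "\<dots> \<le> exp (- 3 * t)" using wexp[OF that] by simp
    also have "\<dots> \<le> exp (- t)" using that by simp
    finally show ?thesis
      using divide_pos_pos[OF wpos[OF that] nz[of t]] unfolding f0 real_norm_def by linarith
  qed
  have b1: "norm (f1 t) \<le> norm (exp (- t))" if "t > 0" for t
  proof -
    have te: "t \<le> exp t" using exp_ge_add_one_self[of t] by linarith
    have "t * w t / (1 + t\<^sup>2) \<le> t * w t / 1"
      using wpos[OF that] that nz[of t] by (intro divide_left_mono) auto
    also have "\<dots> \<le> exp t * exp (- 3 * t)"
      using wexp[OF that] wpos[OF that] te
      by (simp, intro mult_mono) auto
    also have "\<dots> \<le> exp (- t)" using that by (simp flip: exp_add)
    finally show ?thesis
      using divide_pos_pos[OF mult_pos_pos[OF that wpos[OF that]] nz[of t]]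
      unfolding f1[OF that] real_norm_def by linarith
  qed
  have i0: "set_integrable lborel {0<..} f0"
    by (rule set_integrable_bound[OF E meas(1)]) (use b0 in auto)
  have i1: "set_integrable lborel {0<..} f1"
    by (rule set_integrable_bound[OF E meas(2)]) (use b1 in auto)
  have wd: "(w has_real_derivative w t * (\<alpha> * (1 / t - 1 - \<delta> t))) (at t)" if "t > 0" for t
    unfolding w_def \<delta>_def using sinh_weight_deriv[of \<alpha> t] that \<alpha> by simp
  have hd: "(h has_real_derivative dh t) (at t)" for t
  proof -
    have "(h has_real_derivative ((1 + 2 * t) * (1 + t\<^sup>2)\<^sup>2 - (t + t\<^sup>2) * (2 * (1 + t\<^sup>2) * (2 * t))) /
        ((1 + t\<^sup>2)\<^sup>2 * (1 + t\<^sup>2)\<^sup>2)) (at t)"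
      unfolding h_def using nz'[of t] by (auto intro!: derivative_eq_intros)
    moreover have "((1 + 2 * t) * (1 + t\<^sup>2)\<^sup>2 - (t + t\<^sup>2) * (2 * (1 + t\<^sup>2) * (2 * t))) /
        ((1 + t\<^sup>2)\<^sup>2 * (1 + t\<^sup>2)\<^sup>2) =
        ((1 + 2 * t) * (1 + t\<^sup>2) - (t + t\<^sup>2) * (4 * t)) / (1 + t\<^sup>2) ^ 3"
      using nz'[of t] by (simp add: divide_simps) (simp add: eval_nat_numeral algebra_simps)
    moreover have "(1 + 2 * t) * (1 + t\<^sup>2) - (t + t\<^sup>2) * (4 * t) =
        - (2 * t ^ 3 + 3 * t\<^sup>2 - 2 * t - 1)"
      by (simp add: eval_nat_numeral algebra_simps)
    ultimately show ?thesis unfolding dh_def by metis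
  qed
  have kd: "(k has_real_derivative - 1 / (32 * t\<^sup>2)) (at t)" if "t > 0" for t
    unfolding k_def using that
    by (auto intro!: derivative_eq_intros simp: power2_eq_square field_simps)
  have ud: "((\<lambda>t. - t / (\<alpha> * (1 + t\<^sup>2))) has_real_derivative
      - (1 - t\<^sup>2) / (\<alpha> * (1 + t\<^sup>2)\<^sup>2)) (at t)" for t
  proof -
    have "((\<lambda>t. - t / (\<alpha> * (1 + t\<^sup>2))) has_real_derivative
      - ((\<alpha> * (1 + t\<^sup>2) - t * (2 * t * \<alpha>)) / (\<alpha> * (1 + t\<^sup>2) * (\<alpha> * (1 + t\<^sup>2))))) (at t)"
      using nz'[of t] \<alpha> by (auto intro!: derivative_eq_intros)
    moreover have "- ((\<alpha> * (1 + t\<^sup>2) - t * (2 * t * \<alpha>)) /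
        (\<alpha> * (1 + t\<^sup>2) * (\<alpha> * (1 + t\<^sup>2)))) = - (1 - t\<^sup>2) / (\<alpha> * (1 + t\<^sup>2)\<^sup>2)"
      using nz'[of t] \<alpha> by (simp add: divide_simps) (simp add: eval_nat_numeral algebra_simps)
    ultimately show ?thesis by metis
  qed
  have qd: "(q has_real_derivative dq t) (at t)" if "t > 0" for t
  proof -
    have "(q has_real_derivative - (1 - t\<^sup>2) / (\<alpha> * (1 + t\<^sup>2)\<^sup>2) +
        (dh t - (- 1 / (32 * t\<^sup>2))) / \<alpha>\<^sup>2) (at t)"
      unfolding q_def
      by (intro DERIV_add DERIV_cdivide DERIV_diff ud hd kd that)
    then show ?thesis unfolding dq_def by simp
  qed
  \<comment> \<open>A crude bound, used only for the boundary limits. Its sole singularity, 1 / t,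
    comes from \<open>k\<close>.\<close>
  have qb: "\<bar>q t\<bar> \<le> 5 + 1 / t" if t: "t > 0" for t
  proof -
    have \<alpha>2: "\<alpha>\<^sup>2 \<ge> 1" using \<alpha> by (simp add: power2_eq_square mult_ge1_I)
    have "2 * t \<le> 1 + t\<^sup>2" using sum_squares_bound[of 1 t] by simp
    have t1: "t \<le> 1 + t\<^sup>2" using \<open>2 * t \<le> 1 + t\<^sup>2\<close> t by linarith
    have "1 * (1 + t\<^sup>2) \<le> \<alpha> * (1 + t\<^sup>2)" using \<alpha> nz[of t] by (intro mult_right_mono) auto
    then have "t \<le> \<alpha> * (1 + t\<^sup>2)" using t1 by (metis mult_1 order_trans)
    then have a: "\<bar>t / (\<alpha> * (1 + t\<^sup>2))\<bar> \<le> 1" using t t1 \<alpha> nz[of t]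
      by (simp add: abs_mult)
    have "t + t\<^sup>2 \<le> 2 * (1 + t\<^sup>2)\<^sup>2"
    proof -
      have "(1 + t\<^sup>2) * 1 \<le> (1 + t\<^sup>2) * (1 + t\<^sup>2)" by (intro mult_left_mono) auto
      then show ?thesis using t1 by (simp add: power2_eq_square)
    qed
    then have "\<bar>h t\<bar> \<le> 2" unfolding h_def using t nz[of t] by (simp add: divide_le_eq)
    moreover have "\<bar>k t\<bar> \<le> 1 / t + 1"
    proof -
      have "\<bar>1 / t - 1\<bar> \<le> 1 / t + 1" using t by (simp add: abs_le_iff)
      then show ?thesis unfolding k_def by (simp add: abs_mult)
    qed
    ultimately have "\<bar>h t - k t\<bar> \<le> 3 + 1 / t" by linarith
    moreover have "\<bar>(h t - k t) / \<alpha>\<^sup>2\<bar> \<le> \<bar>h t - k t\<bar> / 1"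
      unfolding abs_divide using \<alpha>2 by (intro divide_left_mono) auto
    ultimately have v: "\<bar>(h t - k t) / \<alpha>\<^sup>2\<bar> \<le> 3 + 1 / t" by simp
    have "\<bar>- u + v\<bar> \<le> 5 + e" if "\<bar>u\<bar> \<le> 1" "\<bar>v\<bar> \<le> 3 + e" for u v e :: real
      using that by linarith
    from this[OF a v] show ?thesis unfolding q_def minus_divide_left[symmetric] .
  qed
  have "(LBINT t:{0<..}. f1 t - f0 t) > 0"
  proof (rule set_integral_pos_if_gt_derivative[where G = "\<lambda>t. w t * q t" and g = g])
    show "set_integrable lborel {0<..} (\<lambda>t. f1 t - f0 t)"
      using i0 i1 by (intro set_integral_diff)
    show "continuous_on {0<..} (\<lambda>t. f1 t - f0 t)"
      using cont by (intro continuous_intros)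
    show "((\<lambda>t. w t * q t) has_real_derivative g t) (at t)" if "t > 0" for t
      using DERIV_mult[OF wd[OF that] qd[OF that]] by (simp add: g_def mult.commute add.commute)
    show "continuous_on {0<..} g"
      unfolding g_def w_def sinh_weight_def \<delta>_def q_def dq_def h_def k_def dh_def
      using \<alpha> nz' by (auto intro!: continuous_intros)
    show "g t < f1 t - f0 t" if t: "t > 0" for t
    proof -
      have x: "\<alpha> * t > 0" using t \<alpha> by simp
      have x3: "(\<alpha> * t) ^ 3 / 2 > 0" using zero_less_power[OF x] by (rule half_gt_zero)
      have "0 \<le> \<delta> t" unfolding \<delta>_def using x by simp
      moreover have "\<delta> t \<le> 1 / (\<alpha> * t)"
        unfolding \<delta>_def by (rule frac_le[OF _ _ x sinh_mult_exp_ge(1)[OF x]]) auto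
      moreover have "\<delta> t \<le> 1 / ((\<alpha> * t) ^ 3 / 2)"
        unfolding \<delta>_def by (rule frac_le[OF _ _ x3 sinh_mult_exp_ge(2)[OF x]]) auto
      ultimately have d: "0 \<le> \<delta> t" "\<delta> t \<le> 1 / (\<alpha> * t)" "\<delta> t \<le> 2 / (\<alpha> * t) ^ 3"
        by (simp_all only: divide_divide_eq_right mult_1)
      \<comment> \<open>The inequality with the positive weight divided out; multiplying it back
        gives the comparison with \<open>g\<close>.\<close>
      have "\<alpha> * (1 / t - 1 - \<delta> t) * q t + dq t < (t - 1) / (1 + t\<^sup>2)"
        unfolding q_def dq_def
        by (rule derivative_lt_integrand[OF t \<alpha>]) (use d in \<open>auto simp: h_def k_def dh_def\<close>)
      then have "w t * (\<alpha> * (1 / t - 1 - \<delta> t) * q t + dq t) < w t * ((t - 1) / (1 + t\<^sup>2))"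
        using wpos[OF t] by (rule mult_strict_left_mono)
      then show ?thesis unfolding g_def f0 f1[OF t]
        by (simp add: algebra_simps diff_divide_distrib)
    qed
    show "((\<lambda>t. w t * q t) \<longlongrightarrow> 0) (at_right 0)"
    proof (rule Lim_null_comparison)
      show "\<forall>\<^sub>F t in at_right 0. norm (w t * q t) \<le> t\<^sup>2 * (5 + 1 / t)"
      proof (rule eventually_mono[OF eventually_at_right_real[of 0 1]])
        fix t :: real assume "t \<in> {0<..<1}"
        then have t: "0 < t" "t < 1" by auto
        have "w t \<le> t powr (\<alpha> - 1)" unfolding w_def using sinh_weight_le_powr \<alpha> t by simp
        \<comment> \<open>For t < 1 a smaller exponent gives a larger power; the square already
          overcomes the 1 / t in the bound for \<open>q\<close>.\<close>
        also have "\<dots> \<le> t powr 2" using t \<alpha> by (intro powr_mono') auto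
        also have "\<dots> = t\<^sup>2" using t by simp
        finally show "norm (w t * q t) \<le> t\<^sup>2 * (5 + 1 / t)"
          using qb[OF t(1)] wpos[OF t(1)] by (auto simp: abs_mult intro!: mult_mono)
      qed simp
      show "((\<lambda>t::real. t\<^sup>2 * (5 + 1 / t)) \<longlongrightarrow> 0) (at_right 0)" by real_asymp
    qed
    show "((\<lambda>t. w t * q t) \<longlongrightarrow> 0) at_top"
    proof (rule Lim_null_comparison)
      show "\<forall>\<^sub>F t in at_top. norm (w t * q t) \<le> exp (- 3 * t) * (5 + 1 / t)"
      proof (rule eventually_mono[OF eventually_gt_at_top[of 0]])
        fix t :: real assume t: "0 < t"
        show "norm (w t * q t) \<le> exp (- 3 * t) * (5 + 1 / t)"
          using qb[OF t] wpos[OF t] wexp[OF t] by (auto simp: abs_mult intro!: mult_mono)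
      qed
      show "((\<lambda>t::real. exp (- 3 * t) * (5 + 1 / t)) \<longlongrightarrow> 0) at_top" by real_asymp
    qed
  qed
  then show "(LBINT t:{0<..}. t powr (\<alpha> + 1) / sinh (\<alpha> * t) * (1 / (1 + t\<^sup>2)))
   - (LBINT t:{0<..}. t powr \<alpha> / sinh (\<alpha> * t) * (1 / (1 + t\<^sup>2))) > 0"
    using set_integral_diff(2)[OF i1 i0] by (simp add: f0_def f1_def)
qed simp

end
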